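(* Let $\ell$ and $k$ be integers with $2 \le \ell < k$, and let $H$ be an $\ell$-covering $k$-hypergraph. Then $H$ admits an Euler family if and only if $H$ has at least two edges.
   Context: A hypergraph $H$ is a pair $(V,E)$ where $V$ is a non-empty finite set (the vertices) and $E$ is a finite multiset of subsets of $V$ (the edges); repeated (parallel) edges are allowed and count as distinct edges. $H$ is empty if it has no edges, and is $k$-uniform if every edge has cardinality $k$. For integers $2\le \ell<k$, an $\ell$-covering $k$-hypergraph is a non-empty (i.e. having at least one edge) $k$-uniform hypergraph in which every $\ell$-subset of vertices is contained in at least one edge. A $(v_0,v_s)$-walk in $H$ is a sequence $W=v_0e_1v_1e_2\ldots e_sv_s$ with $v_0,\ldots,v_s\in V$, $e_1,\ldots,e_s\in E$, and $v_{i-1},v_i\in e_i$ with $v_{i-1}\ne v_i$ for all $i=1,\ldots,s$. It traverses each of the vertices and edges in the sequence; the vertices $v_0,\ldots,v_s$ are its anchors. $W$ is a trail if $e_1,\ldots,e_s$ are pairwise distinct (as members of the multiset $E$), and it is closed if $v_0=v_s$ and $s\ge 2$. An Euler family of $H$ is a collection of pairwise anchor-disjoint and pairwise edge-disjoint closed trails that jointly traverse every edge of $H$. *)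

theory Defs
  imports Main "HOL-Library.Multiset"
begin

definition hypergraph :: "'a set \<Rightarrow> 'a set multiset \<Rightarrow> bool" where
  "hypergraph V E \<longleftrightarrow> finite V \<and> V \<noteq> {} \<and> (\<forall>e\<in>#E. e \<subseteq> V)"

definition uniform :: "nat \<Rightarrow> 'a set multiset \<Rightarrow> bool" where
  "uniform k E \<longleftrightarrow> (\<forall>e\<in>#E. card e = k)"

definition covering_hypergraph :: "nat \<Rightarrow> nat \<Rightarrow> 'a set \<Rightarrow> 'a set multiset \<Rightarrow> bool" where
  "covering_hypergraph l k V E \<longleftrightarrow>
     hypergraph V E \<and> E \<noteq> {#} \<and> uniform k E \<and>
     (\<forall>S. S \<subseteq> V \<and> card S = l \<longrightarrow> (\<exists>e\<in>#E. S \<subseteq> e))"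

text \<open>
  A member of the edge multiset is a pair (e, i): the underlying vertex set e together with an
  index i telling apart the parallel copies of e, so that parallel edges are distinct edges.
\<close>

type_synonym 'a edge = "'a set \<times> nat"

definition edges :: "'a set multiset \<Rightarrow> 'a edge set" where
  "edges E = {(e, i). i < count E e}"

text \<open>
  The walk v0 e1 v1 e2 ... es vs is represented by the list [v0, ..., vs] of its anchors
  and the list [e1, ..., es] of its edges.
\<close>

type_synonym 'a walk = "'a list \<times> 'a edge list"

definition anchors :: "'a walk \<Rightarrow> 'a set" where
  "anchors W = set (fst W)"

definition walk_edges :: "'a walk \<Rightarrow> 'a edge set" where
  "walk_edges W = set (snd W)"

definition is_walk :: "'a set \<Rightarrow> 'a set multiset \<Rightarrow> 'a walk \<Rightarrow> bool" where
  "is_walk V E W \<longleftrightarrow> (case W of (vs, es) \<Rightarrow>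
     length vs = Suc (length es) \<and> set vs \<subseteq> V \<and> set es \<subseteq> edges E \<and>
     (\<forall>i<length es. vs ! i \<in> fst (es ! i) \<and> vs ! Suc i \<in> fst (es ! i) \<and> vs ! i \<noteq> vs ! Suc i))"

definition is_trail :: "'a set \<Rightarrow> 'a set multiset \<Rightarrow> 'a walk \<Rightarrow> bool" where
  "is_trail V E W \<longleftrightarrow> is_walk V E W \<and> distinct (snd W)"

definition closed_walk :: "'a walk \<Rightarrow> bool" where
  "closed_walk W \<longleftrightarrow> hd (fst W) = last (fst W) \<and> length (snd W) \<ge> 2"

definition euler_family :: "'a set \<Rightarrow> 'a set multiset \<Rightarrow> 'a walk set \<Rightarrow> bool" where
  "euler_family V E F \<longleftrightarrow>
     (\<forall>W\<in>F. is_trail V E W \<and> closed_walk W) \<and>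
     pairwise (\<lambda>W W'. anchors W \<inter> anchors W' = {}) F \<and>
     pairwise (\<lambda>W W'. walk_edges W \<inter> walk_edges W' = {}) F \<and>
     (\<Union>W\<in>F. walk_edges W) = edges E"

end

theory Submission imports Defs begin

text \<open>
  An Euler family exists iff one can pick two vertices from every edge so that every vertex is
  picked an even number of times: the maximal closed trails of the resulting even multigraph are
  pairwise disjoint. The possible sets of oddly picked vertices form an even delta-matroid with
  simultaneous exchange. If a minimum member \<open>T\<close> is non-empty, delete edges one by one as long as this
  either raises the minimum by 2, or, after complementing the target parity on the deleted edge,
  raises it by \<open>k - 2\<close>. With \<open>s\<close> and \<open>t\<close> edges deleted in these two ways, the final minimum
  set has at least \<open>2 + 2s + (k - 2)t\<close> vertices. No remaining edge contains two of them, and their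
  parallel classes in the matroid of minimum sets are unions of components of the remaining
  hypergraph, each meeting the toggled set, so there are at most \<open>kt\<close> of them. All pairs of these
  vertices are then covered by the \<open>s + t\<close> deleted edges, which is impossible by counting, except
  when \<open>s = 0\<close> and \<open>t \<le> 2\<close>; these cases are treated directly.
\<close>

subsection \<open>Pair choices form a delta-matroid\<close>

abbreviation symd :: "'a set \<Rightarrow> 'a set \<Rightarrow> 'a set"  (infixl "\<triangle>" 65)
  where "A \<triangle> B \<equiv> (A - B) \<union> (B - A)"

definition odd_sum :: "'a set multiset \<Rightarrow> 'a set" where
  "odd_sum M = {x. odd (size {#s \<in># M. x \<in> s#})}"

lemma odd_sum_simps [simp]:
  "odd_sum {#} = {}"
  "odd_sum (add_mset s M) = s \<triangle> odd_sum M"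
  "odd_sum (M + N) = odd_sum M \<triangle> odd_sum N"
  by (auto simp: odd_sum_def)

lemma subset_add_mset_cases:
  assumes "N \<subseteq># add_mset s M"
  obtains "N \<subseteq># M" | N' where "N = add_mset s N'" "N' \<subseteq># M"
proof (cases "s \<in># N")
  case True
  then obtain N' where "N = add_mset s N'" by (metis insert_DiffM)
  with assms that(2) show ?thesis by auto
next
  case False
  with assms have "N \<subseteq># M"
    by (metis subset_mset.inf.absorb_iff2 inter_add_left1 inf.commute subset_mset.inf_commute)
  with that(1) show ?thesis .
qed

lemma subset_union_mset_split:
  assumes "N \<subseteq># M + L"
  obtains N1 N2 where "N = N1 + N2" "N1 \<subseteq># M" "N2 \<subseteq># L"
proof
  show "N = (N \<inter># M) + (N - M)"
    by (metis diff_intersect_left_idem subset_mset.add_diff_inverse subset_mset.inf_le1)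
  show "N - M \<subseteq># L" using assms by (metis add.commute subset_eq_diff_conv)
qed auto

text \<open>
  A handshake argument: follow a trail from \<open>u\<close> in the multigraph \<open>M\<close> until it cannot be extended.
\<close>
lemma handshake_trail:
  assumes M: "\<forall>s\<in>#M. card s = 2" and u: "u \<in> odd_sum M"
  obtains N v where "N \<subseteq># M" "v \<noteq> u" "v \<in> odd_sum M" "odd_sum N = {u, v}"
proof -
  \<comment> \<open>A sub-multiset with odd set \<open>{u, v}\<close> stands for a trail from
    \<open>u\<close> to \<open>v\<close>. A largest one replaces a trail that cannot be
    extended.\<close>
  define P where "P = (\<lambda>N. N \<subseteq># M \<and> (\<exists>v. v \<noteq> u \<and> odd_sum N = {u, v}))"
  have PI: "P N" if "N \<subseteq># M" "v \<noteq> u" "odd_sum N = {u, v}" for N v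
    unfolding P_def using that by blast
  have extend: "\<exists>w. w \<noteq> x \<and> {x, w} \<in># M - N"
    if "N \<subseteq># M" "x \<in> odd_sum M \<longleftrightarrow> x \<notin> odd_sum N" for N x
  proof -
    have "odd_sum M = odd_sum N \<triangle> odd_sum (M - N)"
      by (metis odd_sum_simps(3) subset_mset.add_diff_inverse that(1))
    with that(2) have "x \<in> odd_sum (M - N)" by auto
    then have "{#s \<in># M - N. x \<in> s#} \<noteq> {#}" unfolding odd_sum_def by fastforce
    then obtain s where s: "s \<in># M - N" "x \<in> s"
      by (metis (mono_tags, lifting) mem_Collect_eq multiset_nonemptyE set_mset_filter)
    then have "card s = 2" using M by (meson in_diffD)
    then obtain a b where "s = {a, b}" "a \<noteq> b" by (meson card_2_iff)
    with s show ?thesis by (auto simp: insert_commute)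
  qed
  have add: "add_mset s N \<subseteq># M" if "N \<subseteq># M" "s \<in># M - N" for s N
    using that by (simp add: subseteq_mset_def in_diff_count Suc_le_eq)
  obtain w where w: "w \<noteq> u" "{u, w} \<in># M" using extend[of "{#}" u] u by auto
  then have "P {#{u, w}#}" by (intro PI[of _ w]) auto
  moreover have "\<forall>N. P N \<longrightarrow> size N < Suc (size M)" by (simp add: P_def size_mset_mono less_Suc_eq_le)
  ultimately obtain N where N: "P N" "\<And>L. P L \<Longrightarrow> size L \<le> size N"
    using ex_has_greatest_nat[of P "{#{u, w}#}" size "Suc (size M)"] by metis
  obtain v where v: "N \<subseteq># M" "v \<noteq> u" "odd_sum N = {u, v}"
    using N(1) unfolding P_def by blast
  have "v \<in> odd_sum M"
  proof (rule ccontr)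
    assume "v \<notin> odd_sum M"
    with v obtain w where w: "w \<noteq> v" "{v, w} \<in># M - N" using extend[of N v] by auto
    let ?N = "add_mset {v, w} N"
    have sub: "?N \<subseteq># M" using add v w by blast
    show False
    proof (cases "w = u")
      case False
      moreover have "odd_sum ?N = {u, w}" using v w False by auto
      ultimately have "P ?N" using PI sub by blast
      then show False using N(2) by fastforce
    next
      case True
      then have em: "odd_sum ?N = {}" using v w by auto
      then obtain z where z: "z \<noteq> u" "{u, z} \<in># M - ?N" using extend[OF sub, of u] u by auto
      have "odd_sum (add_mset {u, z} ?N) = {u, z}"
        unfolding odd_sum_simps(2)[of "{u, z}"] em by simp
      then have "P (add_mset {u, z} ?N)" using PI z(1) add[OF sub z(2)] by blast
      then show False using N(2) by fastforce
    qed
  qed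
  with that v show thesis by blast
qed

section \<open>Choices on a single edge\<close>

definition pick :: "'a set \<Rightarrow> 'a set \<Rightarrow> bool" where
  "pick A P \<longleftrightarrow> P \<subseteq> A \<and> card P = 2"

lemma pick_pair: "y \<in> A \<Longrightarrow> z \<in> A \<Longrightarrow> y \<noteq> z \<Longrightarrow> pick A {y, z}"
  by (simp add: pick_def)

lemma pickE:
  assumes "pick A P" obtains a b where "P = {a, b}" "a \<noteq> b" "a \<in> A" "b \<in> A"
  using assms unfolding pick_def by (metis card_2_iff insert_subset)

text \<open>A strong form of exchange: the pairs of \<open>M\<close> lead from \<open>X\<close> to
  \<open>Y\<close>, and any selection of them may be applied alone. It passes to a larger edge set
  by adding up the multisets \<open>M\<close>.\<close>

definition linked :: "'a set set \<Rightarrow> 'a set \<Rightarrow> 'a set \<Rightarrow> bool" where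
  "linked \<F> X Y \<longleftrightarrow> (\<exists>M. (\<forall>s\<in>#M. card s = 2) \<and> (\<forall>N. N \<subseteq># M \<longrightarrow> X \<triangle> odd_sum N \<in> \<F>) \<and>
     X \<triangle> odd_sum M = Y)"

lemma linkedI:
  assumes "\<And>s. s \<in># M \<Longrightarrow> card s = 2" "\<And>N. N \<subseteq># M \<Longrightarrow> X \<triangle> odd_sum N \<in> \<F>"
    "X \<triangle> odd_sum M = Y"
  shows "linked \<F> X Y"
  unfolding linked_def using assms by blast

lemma subset_mset_single_cases:
  assumes "N \<subseteq># {#s#}" obtains "N = {#}" | "N = {#s#}"
  using assms by (elim subset_add_mset_cases) auto

lemma subset_mset_double_cases:
  assumes "N \<subseteq># {#s, t#}" obtains "N = {#}" | "N = {#s#}" | "N = {#t#}" | "N = {#s, t#}"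
  using assms by (elim subset_add_mset_cases) auto

text \<open>Disjoint pairs are linked by two independent replacements, one per element. Pairs that
  meet need at most one replacement.\<close>

lemma linked_pick:
  assumes "pick A P" "pick A Q"
  shows "linked {P. pick A P} P Q"
proof -
  obtain a b where P: "P = {a, b}" "a \<noteq> b" "a \<in> A" "b \<in> A" using assms pickE by blast
  obtain c d where Q: "Q = {c, d}" "c \<noteq> d" "c \<in> A" "d \<in> A" using assms pickE by blast
  have swap: "linked {P. pick A P} {x, y} {x, z}"
    if "x \<noteq> y" "x \<noteq> z" "x \<in> A" "y \<in> A" "z \<in> A" for x y z
  proof (cases "y = z")
    case True
    then show ?thesis by (intro linkedI[of "{#}"]) (use that in \<open>auto simp: pick_pair\<close>)
  next
    case False
    have eq: "{x, y} \<triangle> odd_sum {#{y, z}#} = {x, z}" using that False by auto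
    show ?thesis
    proof (rule linkedI[OF _ _ eq])
      fix N assume "N \<subseteq># {#{y, z}#}"
      then show "{x, y} \<triangle> odd_sum N \<in> {P. pick A P}"
      proof (cases rule: subset_mset_single_cases)
        case 1
        then show ?thesis using that by (simp add: pick_pair)
      next
        case 2
        show ?thesis unfolding 2 eq using that by (simp add: pick_pair)
      qed
    qed (use False in auto)
  qed
  show ?thesis
  proof (cases "P \<inter> Q = {}")
    case True
    have eqs: "{a, b} \<triangle> odd_sum {#{a, c}#} = {c, b}" "{a, b} \<triangle> odd_sum {#{b, d}#} = {a, d}"
      "{a, b} \<triangle> odd_sum {#{a, c}, {b, d}#} = {c, d}"
      using True P Q by auto
    have ne: "a \<noteq> c" "b \<noteq> d" "c \<noteq> b" "a \<noteq> d" using True P Q by auto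
    show ?thesis unfolding P(1) Q(1)
    proof (rule linkedI[OF _ _ eqs(3)])
      fix N assume "N \<subseteq># {#{a, c}, {b, d}#}"
      then show "{a, b} \<triangle> odd_sum N \<in> {P. pick A P}"
      proof (cases rule: subset_mset_double_cases)
        case 1
        then show ?thesis using P by (simp add: pick_pair)
      next
        case 2
        show ?thesis unfolding 2 eqs using P Q ne by (simp add: pick_pair)
      next
        case 3
        show ?thesis unfolding 3 eqs using P Q ne by (simp add: pick_pair)
      next
        case 4
        show ?thesis unfolding 4 eqs using P Q ne by (simp add: pick_pair)
      qed
    qed (use ne in auto)
  next
    case False
    then consider "a = c" | "a = d" | "b = c" | "b = d" using P Q by auto
    then show ?thesis
      using swap[of a b d] swap[of a b c] swap[of b a d] swap[of b a c] P Q
      by cases (auto simp: insert_commute)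
  qed
qed

section \<open>Choices on all edges\<close>

definition picks :: "('e \<Rightarrow> 'a set) \<Rightarrow> 'e set \<Rightarrow> ('e \<Rightarrow> 'a set) set" where
  "picks A F = {p. \<forall>e\<in>F. pick (A e) (p e)}"

definition odd_vertices :: "'e set \<Rightarrow> ('e \<Rightarrow> 'a set) \<Rightarrow> 'a set" where
  "odd_vertices F p = {x. odd (card {e \<in> F. x \<in> p e})}"

text \<open>\<open>Z\<close> is the target parity: a member is the set of vertices at which some
  choice misses the target. Hence \<open>{}\<close> is a member iff a choice meets the target
  exactly.\<close>

definition feas :: "('e \<Rightarrow> 'a set) \<Rightarrow> 'e set \<Rightarrow> 'a set \<Rightarrow> 'a set set" where
  "feas A F Z = (\<lambda>p. Z \<triangle> odd_vertices F p) ` picks A F"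

lemma odd_vertices_insert:
  assumes "finite F" "e \<notin> F"
  shows "odd_vertices (insert e F) p = odd_vertices F p \<triangle> p e"
proof -
  have "{f \<in> insert e F. x \<in> p f} = (if x \<in> p e then insert e {f \<in> F. x \<in> p f} else {f \<in> F. x \<in> p f})" for x
    by auto
  then have "card {f \<in> insert e F. x \<in> p f} = card {f \<in> F. x \<in> p f} + (if x \<in> p e then 1 else 0)" for x
    using assms by simp
  then show ?thesis unfolding odd_vertices_def by (auto split: if_splits)
qed

lemma symd_assoc: "A \<triangle> B \<triangle> C = A \<triangle> (B \<triangle> C)"
  by auto

lemma feas_insertE:
  assumes "finite F" "e \<notin> F" "T \<in> feas A (insert e F) Z"
  obtains R P where "R \<in> feas A F Z" "pick (A e) P" "T = R \<triangle> P"
proof -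
  obtain p where p: "p \<in> picks A (insert e F)" "T = Z \<triangle> odd_vertices (insert e F) p"
    using assms(3) unfolding feas_def by blast
  show thesis
  proof
    show "Z \<triangle> odd_vertices F p \<in> feas A F Z"
      unfolding feas_def using p(1) by (intro imageI) (simp add: picks_def)
    show "pick (A e) (p e)" using p(1) by (simp add: picks_def)
    show "T = Z \<triangle> odd_vertices F p \<triangle> p e"
      unfolding p(2) odd_vertices_insert[OF assms(1,2)] symd_assoc ..
  qed
qed

lemma feas_insertI:
  assumes "finite F" "e \<notin> F" "R \<in> feas A F Z" "pick (A e) P"
  shows "R \<triangle> P \<in> feas A (insert e F) Z"
proof -
  obtain p where p: "p \<in> picks A F" "R = Z \<triangle> odd_vertices F p"
    using assms(3) unfolding feas_def by blast
  let ?p = "p(e := P)"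
  have "{f \<in> F. x \<in> ?p f} = {f \<in> F. x \<in> p f}" for x using assms(2) by auto
  then have "R \<triangle> P = Z \<triangle> odd_vertices (insert e F) ?p"
    unfolding p(2) odd_vertices_insert[OF assms(1,2)] symd_assoc by (simp add: odd_vertices_def)
  moreover have "?p \<in> picks A (insert e F)" using p(1) assms(4) by (simp add: picks_def)
  ultimately show ?thesis unfolding feas_def by (rule image_eqI)
qed

lemma feas_toggle: "feas A F (Z \<triangle> B) = (\<lambda>W. W \<triangle> B) ` feas A F Z"
proof -
  have "Z \<triangle> B \<triangle> C = Z \<triangle> C \<triangle> B" for C by auto
  then show ?thesis unfolding feas_def image_image by presburger
qed

text \<open>Induction on the edges: the link on \<open>F\<close> and the link between the two picks
  on the new edge act independently, so the sum of their multisets is a link.\<close>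

lemma feas_linked:
  assumes "finite F" "X \<in> feas A F Z" "Y \<in> feas A F Z"
  shows "linked (feas A F Z) X Y"
  using assms
proof (induction F arbitrary: X Y rule: finite_induct)
  case empty
  then show ?case by (intro linkedI[of "{#}"]) (auto simp: feas_def odd_vertices_def)
next
  case (insert e F)
  obtain R P where R: "X = R \<triangle> P" "R \<in> feas A F Z" "pick (A e) P"
    using insert.prems(1) feas_insertE[OF insert.hyps(1,2)] by metis
  obtain R' P' where R': "Y = R' \<triangle> P'" "R' \<in> feas A F Z" "pick (A e) P'"
    using insert.prems(2) feas_insertE[OF insert.hyps(1,2)] by metis
  obtain M where M: "\<forall>s\<in>#M. card s = 2" "\<forall>N. N \<subseteq># M \<longrightarrow> R \<triangle> odd_sum N \<in> feas A F Z"
    "R \<triangle> odd_sum M = R'"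
    using insert.IH[OF R(2) R'(2)] unfolding linked_def by blast
  obtain L where L: "\<forall>s\<in>#L. card s = 2" "\<forall>N. N \<subseteq># L \<longrightarrow> pick (A e) (P \<triangle> odd_sum N)"
    "P \<triangle> odd_sum L = P'"
    using linked_pick[OF R(3) R'(3)] unfolding linked_def by blast
  have re: "X \<triangle> (B \<triangle> C) = (R \<triangle> B) \<triangle> (P \<triangle> C)" for B C unfolding R(1) by auto
  have "X \<triangle> odd_sum N \<in> feas A (insert e F) Z" if N: "N \<subseteq># M + L" for N
  proof -
    obtain N1 N2 where N: "N = N1 + N2" "N1 \<subseteq># M" "N2 \<subseteq># L" using subset_union_mset_split[OF N] .
    then show ?thesis
      unfolding N(1) odd_sum_simps re using M L by (intro feas_insertI[OF insert.hyps(1,2)]) metis+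
  qed
  moreover have "X \<triangle> odd_sum (M + L) = Y"
    unfolding odd_sum_simps re M(3) L(3) R'(1) by simp
  moreover have "\<forall>s\<in>#M + L. card s = 2" using M(1) L(1) by auto
  ultimately show ?case unfolding linked_def by blast
qed

text \<open>The simultaneous exchange property of even delta-matroids: one pair
  \<open>{u, v}\<close> serves both \<open>X\<close> and \<open>Y\<close>, and
  \<open>v \<noteq> u\<close> preserves the parity of sizes.\<close>

definition exchange :: "'a set set \<Rightarrow> bool" where
  "exchange \<F> \<longleftrightarrow> (\<forall>X\<in>\<F>. \<forall>Y\<in>\<F>. \<forall>u\<in>X \<triangle> Y. \<exists>v\<in>X \<triangle> Y. v \<noteq> u \<and> X \<triangle> {u, v} \<in> \<F> \<and> Y \<triangle> {u, v} \<in> \<F>)"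

lemma exchangeE:
  assumes "exchange \<F>" "X \<in> \<F>" "Y \<in> \<F>" "u \<in> X \<triangle> Y"
  obtains v where "v \<in> X \<triangle> Y" "v \<noteq> u" "X \<triangle> {u, v} \<in> \<F>" "Y \<triangle> {u, v} \<in> \<F>"
  using assms unfolding exchange_def by blast

text \<open>\<open>X \<triangle> Y\<close> is the odd set of the linking multiset \<open>M\<close>,
  so the handshake lemma gives a part \<open>N\<close> with odd set \<open>{u, v}\<close>. Applying
  \<open>N\<close> to \<open>X\<close> gives \<open>X \<triangle> {u, v}\<close>, and applying the
  rest \<open>M - N\<close> to \<open>X\<close> stops at
  \<open>Y \<triangle> {u, v}\<close>.\<close>

lemma exchange_feas:
  assumes "finite F" shows "exchange (feas A F Z)"
  unfolding exchange_def
proof (intro ballI)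
  fix X Y u assume X: "X \<in> feas A F Z" and Y: "Y \<in> feas A F Z" and u: "u \<in> X \<triangle> Y"
  obtain M where M: "\<forall>s\<in>#M. card s = 2" "\<forall>N. N \<subseteq># M \<longrightarrow> X \<triangle> odd_sum N \<in> feas A F Z"
    "X \<triangle> odd_sum M = Y"
    using feas_linked[OF assms X Y] unfolding linked_def by blast
  then have XY: "X \<triangle> Y = odd_sum M" by auto
  obtain N v where N: "N \<subseteq># M" "v \<noteq> u" "v \<in> odd_sum M" "odd_sum N = {u, v}"
    using handshake_trail[OF M(1)] u unfolding XY by blast
  have "odd_sum M = odd_sum N \<triangle> odd_sum (M - N)"
    by (metis odd_sum_simps(3) subset_mset.add_diff_inverse N(1))
  then have "X \<triangle> odd_sum (M - N) = Y \<triangle> {u, v}" using M(3) N(4) by auto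
  moreover have "X \<triangle> odd_sum (M - N) \<in> feas A F Z" using M(2) by simp
  moreover have "X \<triangle> {u, v} \<in> feas A F Z" using M(2) N by metis
  ultimately show "\<exists>v\<in>X \<triangle> Y. v \<noteq> u \<and> X \<triangle> {u, v} \<in> feas A F Z \<and> Y \<triangle> {u, v} \<in> feas A F Z"
    unfolding XY using N(2,3) by auto
qed

subsection \<open>Minimum odd sets\<close>

definition base :: "'a set set \<Rightarrow> 'a set \<Rightarrow> bool" where
  "base \<F> T \<longleftrightarrow> T \<in> \<F> \<and> (\<forall>X\<in>\<F>. card T \<le> card X)"

lemma base_exists: "\<F> \<noteq> {} \<Longrightarrow> \<exists>T. base \<F> T"
  unfolding base_def using ex_has_least_nat[of "\<lambda>T. T \<in> \<F>" _ card] by blast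

lemma card_symd_pair:
  assumes "finite R" "y \<noteq> v"
  shows "y \<in> R \<Longrightarrow> v \<in> R \<Longrightarrow> card (R \<triangle> {y, v}) + 2 = card R"
    and "y \<in> R \<Longrightarrow> v \<notin> R \<Longrightarrow> card (R \<triangle> {y, v}) = card R"
    and "y \<notin> R \<Longrightarrow> v \<notin> R \<Longrightarrow> card (R \<triangle> {y, v}) = card R + 2"
proof -
  assume "y \<in> R" "v \<in> R"
  then have "R \<triangle> {y, v} = R - {y, v}" "{y, v} \<subseteq> R" by auto
  moreover from this have "card {y, v} \<le> card R" using assms by (meson card_mono)
  ultimately show "card (R \<triangle> {y, v}) + 2 = card R"
    using assms by (simp add: card_Diff_subset)
next
  assume "y \<in> R" "v \<notin> R"
  moreover from this have "R \<triangle> {y, v} = insert v (R - {y})" by auto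
  ultimately show "card (R \<triangle> {y, v}) = card R"
    using assms card_Suc_Diff1[of R y] by (simp del: card_Diff_insert)
next
  assume "y \<notin> R" "v \<notin> R"
  moreover from this have "R \<triangle> {y, v} = insert y (insert v R)" by auto
  ultimately show "card (R \<triangle> {y, v}) = card R + 2" using assms by simp
qed

text \<open>Local minimality implies global minimality. Exchange at some \<open>y\<close> in
  \<open>T - X\<close> either removes two elements of \<open>T\<close>, or trades an element of
  \<open>X\<close> for \<open>y\<close>; the latter keeps the size of \<open>X\<close> and brings it
  closer to \<open>T\<close>.\<close>

lemma not_minimum_imp_remove_pair:
  assumes ex: "exchange \<F>" and fin: "\<And>X. X \<in> \<F> \<Longrightarrow> finite X"
    and T: "T \<in> \<F>" and X: "X \<in> \<F>" "card X < card T"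
  shows "\<exists>y\<in>T. \<exists>v\<in>T. y \<noteq> v \<and> T - {y, v} \<in> \<F>"
  using X
proof (induction "card (T \<triangle> X)" arbitrary: X rule: less_induct)
  case less
  have "\<not> T \<subseteq> X" using less.prems fin by (meson card_mono not_le)
  then obtain y where y: "y \<in> T" "y \<notin> X" by blast
  then obtain v where v: "v \<in> T \<triangle> X" "v \<noteq> y" "T \<triangle> {y, v} \<in> \<F>" "X \<triangle> {y, v} \<in> \<F>"
    using exchangeE[OF ex T less.prems(1), of y] by blast
  show ?case
  proof (cases "v \<in> T")
    case True
    then have "T \<triangle> {y, v} = T - {y, v}" using y by auto
    then show ?thesis using True y v by metis
  next
    case False
    then have vX: "v \<in> X" using v by auto
    have "card (X \<triangle> {y, v}) = card X"
      using card_symd_pair(2)[of X v y] fin less.prems vX y v(2) by (simp add: insert_commute)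
    moreover have "T \<triangle> (X \<triangle> {y, v}) \<subset> T \<triangle> X" using False vX y by auto
    then have "card (T \<triangle> (X \<triangle> {y, v})) < card (T \<triangle> X)"
      using fin T less.prems by (intro psubset_card_mono) auto
    ultimately show ?thesis using less.hyps v(4) less.prems(2) by metis
  qed
qed

lemma finite_feas:
  assumes "finite F" "finite Z" "\<forall>e\<in>F. finite (A e)" "X \<in> feas A F Z"
  shows "finite X"
  using assms
proof (induction F arbitrary: X rule: finite_induct)
  case empty
  then show ?case by (auto simp: feas_def odd_vertices_def)
next
  case (insert e F)
  obtain R P where R: "R \<in> feas A F Z" "pick (A e) P" "X = R \<triangle> P"
    using feas_insertE[OF insert.hyps(1,2) insert.prems(3)] by metis
  have "finite P" using R(2) by (elim pickE) simp
  moreover have "finite R" using insert.IH insert.prems R(1) by simp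
  ultimately show ?case using R(3) by simp
qed

lemma feas_nonempty:
  assumes "\<forall>e\<in>F. finite (A e) \<and> 2 \<le> card (A e)"
  shows "feas A F Z \<noteq> {}"
proof -
  have "\<forall>e\<in>F. \<exists>P. pick (A e) P"
    using assms unfolding pick_def by (metis obtain_subset_with_card_n)
  then obtain p where "\<forall>e\<in>F. pick (A e) (p e)" by metis
  then show ?thesis unfolding feas_def picks_def by blast
qed

text \<open>
  In the incidence graph the two kinds of removable edges are the edge vertices of the two sets
  in Lovasz's barrier for parity factors.
\<close>
definition removable :: "('e \<Rightarrow> 'a set) \<Rightarrow> 'e set \<Rightarrow> 'a set \<Rightarrow> nat \<Rightarrow> bool" where
  "removable A F Z r \<longleftrightarrow> (\<forall>X\<in>feas A F Z. r + 2 \<le> card X)"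

definition flippable :: "('e \<Rightarrow> 'a set) \<Rightarrow> 'e set \<Rightarrow> 'a set \<Rightarrow> nat \<Rightarrow> 'e \<Rightarrow> bool" where
  "flippable A F Z r e \<longleftrightarrow> (\<forall>X\<in>feas A F (Z \<triangle> A e). r + card (A e) \<le> card X + 2)"

section \<open>Comparing the families with and without one edge\<close>

locale minimum_pick =
  fixes A :: "'e \<Rightarrow> 'a set" and F :: "'e set" and e :: 'e and Z T :: "'a set"
  assumes F: "finite F" "e \<notin> F" and Z: "finite Z" and A: "\<forall>f\<in>insert e F. finite (A f)"
    and A3: "3 \<le> card (A e)" and T: "base (feas A (insert e F) Z) T"
begin

abbreviation "G \<equiv> feas A F Z"
abbreviation "H \<equiv> feas A (insert e F) Z"

lemma fin_G: "R \<in> G \<Longrightarrow> finite R"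
  using finite_feas[OF F(1) Z] A by blast

lemma fin_T: "finite T"
  using finite_feas[OF _ Z A] T F by (auto simp: base_def)

lemma card_pick_ge: "R \<in> G \<Longrightarrow> pick (A e) P \<Longrightarrow> card T \<le> card (R \<triangle> P)"
  using T feas_insertI[OF F] unfolding base_def by blast

lemma base_pick: "R \<in> G \<Longrightarrow> pick (A e) P \<Longrightarrow> card (R \<triangle> P) = card T \<Longrightarrow> base H (R \<triangle> P)"
  using T feas_insertI[OF F] unfolding base_def by metis

text \<open>A suitable pick on \<open>e\<close> turns \<open>R\<close> into a member of
  \<open>H\<close>, whose size is at least \<open>card T\<close>. With two, one or no known elements
  of \<open>R\<close> in \<open>A e\<close>, the size of \<open>R\<close> is at least
  \<open>card T + 2\<close>, \<open>card T\<close> or \<open>card T - 2\<close>;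
  \<open>card_one\<close> and \<open>card_zero\<close> are the other two bounds.\<close>

lemma card_two: "R \<in> G \<Longrightarrow> y \<in> R \<Longrightarrow> v \<in> R \<Longrightarrow> y \<in> A e \<Longrightarrow> v \<in> A e \<Longrightarrow> y \<noteq> v \<Longrightarrow> card T + 2 \<le> card R"
  using card_pick_ge[of R "{y, v}"] card_symd_pair(1)[of R y v] fin_G pick_pair[of y "A e" v] by fastforce

lemma obtain_other: obtains z where "z \<in> A e" "z \<noteq> y"
proof -
  have "\<not> A e \<subseteq> {y}" using A3 card_mono[of "{y}" "A e"] by auto
  then show thesis using that by blast
qed

lemma card_one: "card T \<le> card R" if "R \<in> G" "y \<in> R" "y \<in> A e"
proof -
  obtain z where z: "z \<in> A e" "z \<noteq> y" using obtain_other .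
  show ?thesis
  proof (cases "z \<in> R")
    case True
    then show ?thesis using card_two[of R y z] that z by force
  next
    case False
    then show ?thesis
      using card_pick_ge[OF that(1) pick_pair[OF that(3) z(1)]] card_symd_pair(2)[of R y z] that z fin_G by simp
  qed
qed

lemma card_zero: "card T \<le> card R + 2" if "R \<in> G"
proof -
  obtain y where y: "y \<in> A e" using A3 by fastforce
  obtain z where z: "z \<in> A e" "z \<noteq> y" using obtain_other .
  have "card (R \<triangle> {y, z}) \<le> card R + 2"
    using card_symd_pair[of R y z] card_symd_pair(2)[of R z y] fin_G[OF that] z(2)
    by (cases "y \<in> R"; cases "z \<in> R") (auto simp: insert_commute)
  then show ?thesis using card_pick_ge[OF that pick_pair[OF y z(1)]] z by simp
qed

lemma base_swap:
  assumes "R \<in> G" "y \<in> R" "y \<in> A e" "x \<in> A e" "x \<notin> R" "card R = card T"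
  shows "\<exists>T'. base H T' \<and> x \<in> T'"
proof -
  have "y \<noteq> x" using assms by auto
  then have "base H (R \<triangle> {y, x})"
    using assms fin_G card_symd_pair(2)[of R y x] by (intro base_pick pick_pair) auto
  then show ?thesis using assms by blast
qed

text \<open>Toggling the target translates \<open>G\<close> by \<open>A e\<close>, so
  \<open>R \<triangle> A e\<close> is feasible for the new target. If no pair can be removed from
  it, it is a minimum there, and its size gives the bound. \<open>removableI\<close> is the same
  argument without the toggle.\<close>

lemma flippableI:
  assumes R: "R \<in> G" "card T + card (A e) \<le> card (R \<triangle> A e) + 2"
    and no: "\<And>y v. y \<in> R \<triangle> A e \<Longrightarrow> v \<in> R \<triangle> A e \<Longrightarrow> y \<noteq> v \<Longrightarrow> R \<triangle> {y, v} \<in> G \<Longrightarrow> False"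
  shows "flippable A F Z (card T) e"
  unfolding flippable_def
proof (rule ccontr)
  assume "\<not> (\<forall>X\<in>feas A F (Z \<triangle> A e). card T + card (A e) \<le> card X + 2)"
  then obtain X where X: "X \<in> feas A F (Z \<triangle> A e)" "card X < card (R \<triangle> A e)" using R(2) by force
  have "R \<triangle> A e \<in> feas A F (Z \<triangle> A e)" unfolding feas_toggle using R(1) by (rule imageI)
  moreover have "finite X" if "X \<in> feas A F (Z \<triangle> A e)" for X
    using finite_feas[OF F(1) _ _ that] Z A by simp
  ultimately obtain y v where yv: "y \<in> R \<triangle> A e" "v \<in> R \<triangle> A e" "y \<noteq> v"
    "R \<triangle> A e - {y, v} \<in> feas A F (Z \<triangle> A e)"
    using not_minimum_imp_remove_pair[OF exchange_feas[OF F(1)] _ _ X] by metis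
  from yv(4) obtain W where W: "R \<triangle> A e - {y, v} = W \<triangle> A e" "W \<in> G"
    unfolding feas_toggle by (rule imageE)
  have "W = (W \<triangle> A e) \<triangle> A e" by auto
  also have "\<dots> = R \<triangle> {y, v}" unfolding W(1)[symmetric] using yv by auto
  finally show False using no yv W(2) by blast
qed

lemma removableI:
  assumes R: "R \<in> G" "card T + 2 \<le> card R"
    and no: "\<And>y v. y \<in> R \<Longrightarrow> v \<in> R \<Longrightarrow> y \<noteq> v \<Longrightarrow> R - {y, v} \<in> G \<Longrightarrow> False"
  shows "removable A F Z (card T)"
  unfolding removable_def
proof (rule ccontr)
  assume "\<not> (\<forall>X\<in>G. card T + 2 \<le> card X)"
  then obtain X where X: "X \<in> G" "card X < card R" using R(2) by force
  then show False
    using not_minimum_imp_remove_pair[OF exchange_feas[OF F(1)] fin_G R(1) X] no by blast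
qed

text \<open>The last clause merely orders the pick: the mixed case is always
  \<open>a \<in> T\<close>, \<open>b \<notin> T\<close>, which leaves three cases.\<close>

lemma obtain_pick:
  obtains R a b where "R \<in> G" "a \<noteq> b" "a \<in> A e" "b \<in> A e" "R = T \<triangle> {a, b}"
    "a \<in> T \<or> b \<notin> T"
proof -
  obtain R P where R: "R \<in> G" "pick (A e) P" "T = R \<triangle> P"
    using T feas_insertE[OF F] unfolding base_def by metis
  obtain a b where P: "P = {a, b}" "a \<noteq> b" "a \<in> A e" "b \<in> A e" using pickE[OF R(2)] .
  have "R = T \<triangle> {a, b}" "{a, b} = {b, a}" using R(3) P(1) by auto
  then show thesis using that[of R a b] that[of R b a] R(1) P by metis
qed

text \<open>The pick on \<open>e\<close> that produced \<open>T\<close> decides: both ends in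
  \<open>T\<close> make \<open>e\<close> flippable, both outside make it removable, and the mixed
  case violates minimality.\<close>

lemma two_tokens:
  assumes "u \<in> T" "v \<in> T" "u \<in> A e" "v \<in> A e" "u \<noteq> v"
  shows "removable A F Z (card T) \<or> flippable A F Z (card T) e"
proof -
  obtain R a b where R: "R \<in> G" "a \<noteq> b" "a \<in> A e" "b \<in> A e" "R = T \<triangle> {a, b}" "a \<in> T \<or> b \<notin> T"
    using obtain_pick .
  consider "a \<in> T" "b \<in> T" | "a \<in> T" "b \<notin> T" | "a \<notin> T" "b \<notin> T" using R(6) by blast
  then show ?thesis
  proof cases
    case 1
    then have cR: "card R + 2 = card T" using R card_symd_pair(1)[OF fin_T R(2)] by simp
    \<comment> \<open>Here \<open>R\<close> is \<open>T\<close> without \<open>a\<close> and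
      \<open>b\<close>, too small to meet \<open>A e\<close>. So \<open>R \<triangle> A e\<close> is
      a disjoint union of size \<open>card T + card (A e) - 2\<close>.\<close>
    have disj: "R \<inter> A e = {}" using card_one[OF R(1)] cR by fastforce
    have "flippable A F Z (card T) e"
    proof (rule flippableI[OF R(1)])
      have "R \<triangle> A e = R \<union> A e" using disj by auto
      then show "card T + card (A e) \<le> card (R \<triangle> A e) + 2"
        using disj cR card_Un_disjoint[OF _ _ disj] fin_G[OF R(1)] A by simp
    next
      fix y v assume yv: "y \<in> R \<triangle> A e" "v \<in> R \<triangle> A e" "y \<noteq> v" and mem: "R \<triangle> {y, v} \<in> G"
      have fR: "finite R" using fin_G[OF R(1)] .
      consider "y \<in> A e" "v \<in> A e" "y \<notin> R" "v \<notin> R" | "y \<in> R" "v \<in> R"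
        | "y \<in> A e" "v \<in> R" "y \<notin> R" | "y \<in> R" "v \<in> A e" "v \<notin> R" using yv disj by auto
      then show False
      proof cases
        case 1
        then show False using card_symd_pair(3)[OF fR yv(3)] card_two[OF mem, of y v] yv(3) cR by simp
      next
        case 2
        then show False using card_symd_pair(1)[OF fR yv(3)] card_zero[OF mem] cR by simp
      next
        case 3
        then show False
          using card_symd_pair(2)[OF fR, of v y] card_one[OF mem, of y] yv(3) cR by (simp add: insert_commute)
      next
        case 4
        then show False
          using card_symd_pair(2)[OF fR, of y v] card_one[OF mem, of v] yv(3) cR by simp
      qed
    qed
    then show ?thesis ..
  next
    case 2
    then have cR: "card R = card T" using R card_symd_pair(2)[OF fin_T R(2)] by simp
    \<comment> \<open>Since \<open>R\<close> arises from \<open>T\<close> by trading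
      \<open>a\<close> for \<open>b\<close>, it keeps the size of \<open>T\<close> but contains the
      two vertices \<open>w\<close> and \<open>b\<close> of \<open>A e\<close>.\<close>
    obtain w where "w \<in> T" "w \<in> A e" "w \<noteq> a" using assms by metis
    then have "card T + 2 \<le> card R" using card_two[OF R(1), of w b] R 2 by auto
    then show ?thesis using cR by simp
  next
    case 3
    then have cR: "card R = card T + 2" using R card_symd_pair(3)[OF fin_T R(2)] by simp
    have "removable A F Z (card T)"
    proof (rule removableI[OF R(1)])
      show "card T + 2 \<le> card R" using cR by simp
      fix y z assume yz: "y \<in> R" "z \<in> R" "y \<noteq> z" and mem: "R - {y, z} \<in> G"
      have "R \<triangle> {y, z} = R - {y, z}" using yz by auto
      then have c: "card (R - {y, z}) = card T"
        using card_symd_pair(1)[OF fin_G[OF R(1)] yz(3) yz(1,2)] cR by simp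
      \<comment> \<open>\<open>R\<close> has four vertices in \<open>A e\<close>. After removing any
        pair two of them remain, while the size has dropped to \<open>card T\<close>, against
        \<open>card_two\<close>.\<close>
      have sub: "{u, v, a, b} \<subseteq> R \<inter> A e" using R 3 assms by auto
      have "card ({u, v, a, b} - {y, z}) \<ge> 2"
      proof -
        have "card {u, v, a, b} = 4" using assms 3 R by (auto simp: card_insert_if)
        moreover have "card {y, z} = 2" using yz by simp
        ultimately show ?thesis using diff_card_le_card_Diff[of "{y, z}" "{u, v, a, b}"] by simp
      qed
      then obtain s t where "s \<in> {u, v, a, b} - {y, z}" "t \<in> {u, v, a, b} - {y, z}" "s \<noteq> t"
        by (metis card_le_Suc0_iff_eq finite.emptyI finite.insertI finite_Diff not_less_eq_eq numeral_2_eq_2)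
      then show False using card_two[OF mem, of s t] sub c by auto
    qed
    then show ?thesis ..
  qed
qed

text \<open>If \<open>x\<close> were in no minimum set, that is, a loop of the matroid, the pick on
  \<open>e\<close> that produced \<open>T\<close> would again make \<open>e\<close> flippable or
  removable.\<close>

lemma token_neighbour:
  assumes u: "u \<in> T" "u \<in> A e" and x: "x \<in> A e"
    and irr: "\<not> removable A F Z (card T)" "\<not> flippable A F Z (card T) e"
  shows "\<exists>T'. base H T' \<and> x \<in> T'"
proof (rule ccontr)
  assume loop: "\<not> ?thesis"
  then have xT: "x \<notin> T" using T by blast
  then have xu: "x \<noteq> u" using u by auto
  have TA: "T \<inter> A e = {u}" using two_tokens u irr by blast
  obtain R a b where R: "R \<in> G" "a \<noteq> b" "a \<in> A e" "b \<in> A e" "R = T \<triangle> {a, b}" "a \<in> T \<or> b \<notin> T"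
    using obtain_pick .
  have fR: "finite R" using fin_G[OF R(1)] .
  show False
  proof (cases "a \<in> T")
    case True
    then have a: "a = u" using TA R by auto
    then have b: "b \<notin> T" using TA R by auto
    have cR: "card R = card T" using R card_symd_pair(2)[OF fin_T R(2)] True b by simp
    \<comment> \<open>Otherwise \<open>b\<close> could be traded for \<open>x\<close>, giving a
      minimum set through \<open>x\<close>. So \<open>x\<close> is the only vertex of
      \<open>R\<close> in \<open>A e\<close>.\<close>
    have "b = x" using base_swap[OF R(1), of b x] R b xT loop cR x xu a by auto
    then have RA: "R \<inter> A e = {x}" using TA R a x xu by auto
    have "flippable A F Z (card T) e"
    proof (rule flippableI[OF R(1)])
      have "R \<triangle> A e = R \<union> A e - {x}" using RA by auto
      moreover have "card (R \<union> A e) + 1 = card R + card (A e)"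
        using card_Un_Int[of R "A e"] RA fR A by simp
      moreover have "x \<in> R" using RA by auto
      ultimately show "card T + card (A e) \<le> card (R \<triangle> A e) + 2"
        using cR fR A by (simp add: card_Diff_singleton)
    next
      fix y v assume yv: "y \<in> R \<triangle> A e" "v \<in> R \<triangle> A e" "y \<noteq> v" and mem: "R \<triangle> {y, v} \<in> G"
      have xR: "x \<in> R" "x \<noteq> y" "x \<noteq> v" using RA yv by auto
      consider "y \<in> A e" "v \<in> A e" | "y \<in> R" "v \<in> R"
        | "y \<in> A e" "v \<in> R" "y \<notin> R" | "y \<in> R" "v \<in> A e" "v \<notin> R" using yv by auto
      then show False
      proof cases
        case 1
        \<comment> \<open>Picking \<open>{y, v}\<close> on \<open>e\<close> gives back
          \<open>R\<close>, which would be a minimum set containing \<open>x\<close>.\<close>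
        have "R \<triangle> {y, v} \<triangle> {y, v} = R" by auto
        then have "base H R" using base_pick[OF mem pick_pair[OF 1 yv(3)]] cR by simp
        then show False using loop xR by blast
      next
        case 2
        then show False
          using card_symd_pair(1)[OF fR yv(3)] card_one[OF mem, of x] x xR cR by simp
      next
        case 3
        then show False
          using card_symd_pair(2)[OF fR, of v y] card_two[OF mem, of x y] yv(3) x xR cR
          by (simp add: insert_commute)
      next
        case 4
        then show False
          using card_symd_pair(2)[OF fR, of y v] card_two[OF mem, of x v] yv(3) x xR cR by simp
      qed
    qed
    then show False using irr by simp
  next
    case False
    then have ab: "a \<notin> T" "b \<notin> T" using R(6) by auto
    have cR: "card R = card T + 2" using R card_symd_pair(3)[OF fin_T R(2)] ab by simp
    have uR: "u \<in> R" "a \<in> R" "b \<in> R" using u ab R by auto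
    \<comment> \<open>Choosing \<open>u\<close> together with the other end of the pick moves the
      element \<open>u\<close> of \<open>T\<close> to \<open>c\<close>, so neither end of the pick
      can be \<open>x\<close>.\<close>
    have moves: "\<exists>T'. base H T' \<and> c \<in> T'" if c: "c \<in> {a, b}" for c
    proof -
      obtain d where d: "{c, d} = {a, b}" "c \<noteq> d" using c R(2) by blast
      then have du: "d \<noteq> u" "d \<in> R" "d \<in> A e" "c \<in> R" "c \<noteq> u" using uR R ab u by (auto simp: doubleton_eq_iff)
      then have "card (R \<triangle> {u, d}) = card T"
        using card_symd_pair(1)[OF fR, of u d] uR cR by simp
      then have "base H (R \<triangle> {u, d})" using base_pick[OF R(1) pick_pair] u du by metis
      then show ?thesis using du d by blast
    qed
    then have xab: "x \<notin> {a, b}" using loop by blast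
    then have xR: "x \<notin> R" using R xT by auto
    have "removable A F Z (card T)"
    proof (rule removableI[OF R(1)])
      show "card T + 2 \<le> card R" using cR by simp
      fix y z assume yz: "y \<in> R" "z \<in> R" "y \<noteq> z" and mem: "R - {y, z} \<in> G"
      have "R \<triangle> {y, z} = R - {y, z}" using yz by auto
      then have c: "card (R - {y, z}) = card T"
        using card_symd_pair(1)[OF fR yz(3) yz(1,2)] cR by simp
      \<comment> \<open>One of the three vertices \<open>u\<close>, \<open>a\<close>,
        \<open>b\<close> survives the removal of \<open>{y, z}\<close> and can then be traded for
        \<open>x\<close>.\<close>
      have "u \<noteq> a" "u \<noteq> b" using u ab by auto
      then obtain s where "s \<in> {u, a, b}" "s \<notin> {y, z}" using R(2) by blast
      then have "s \<in> R - {y, z}" "s \<in> A e" using uR R u by auto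
      then show False using base_swap[OF mem _ _ x _ c] xR loop by blast
    qed
    then show False using irr by simp
  qed
qed

end

text \<open>This makes parallelism transitive: a non-loop \<open>w\<close> cannot be parallel to
  both of two independent elements. Bringing \<open>w\<close> into \<open>B\<close> expels a single
  element, so \<open>u\<close> or \<open>v\<close> stays.\<close>

lemma base_exchange_transitive:
  assumes ex: "exchange \<F>" and fin: "\<And>X. X \<in> \<F> \<Longrightarrow> finite X"
    and B: "base \<F> B" "u \<in> B" "v \<in> B" "u \<noteq> v" and B': "base \<F> B'" "w \<in> B'"
  shows "\<exists>C. base \<F> C \<and> w \<in> C \<and> (u \<in> C \<or> v \<in> C)"
proof (cases "w \<in> B")
  case False
  have mem: "B \<in> \<F>" "B' \<in> \<F>" "card B' = card B" using B B' by (auto simp: base_def le_antisym)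
  obtain y where y: "y \<in> B \<triangle> B'" "y \<noteq> w" "B \<triangle> {w, y} \<in> \<F>" "B' \<triangle> {w, y} \<in> \<F>"
    using exchangeE[OF ex mem(1,2), of w] False B' by blast
  have "y \<in> B"
  proof (rule ccontr)
    assume "y \<notin> B"
    then have "y \<in> B'" using y by auto
    then have "card (B' \<triangle> {w, y}) < card B'"
      using card_symd_pair(1)[of B' w y] fin mem B' y by fastforce
    then show False using B'(1) y(4) unfolding base_def by fastforce
  qed
  then have "card (B \<triangle> {w, y}) = card B"
    using card_symd_pair(2)[of B y w] fin mem False y by (simp add: insert_commute)
  then have "base \<F> (B \<triangle> {w, y})" using B(1) y(3) unfolding base_def by metis
  moreover have "w \<in> B \<triangle> {w, y}" "u \<in> B \<triangle> {w, y} \<or> v \<in> B \<triangle> {w, y}" using False B y by auto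
  ultimately show ?thesis by blast
qed (use B in blast)

subsection \<open>Irreducible instances and covering by pairs\<close>

definition irreducible_picks :: "('e \<Rightarrow> 'a set) \<Rightarrow> 'e set \<Rightarrow> 'a set \<Rightarrow> bool" where
  "irreducible_picks A F Z \<longleftrightarrow> (\<forall>T e. base (feas A F Z) T \<longrightarrow> e \<in> F \<longrightarrow>
     \<not> removable A (F - {e}) Z (card T) \<and> \<not> flippable A (F - {e}) Z (card T) e)"

text \<open>\<open>S\<close> collects the edges deleted as removable, \<open>R\<close> those deleted
  with a toggle of the target. The gains 2 and \<open>k - 2\<close> are written without subtraction,
  and each toggle adds at most \<open>k\<close> vertices to the target.\<close>

lemma reduce_to_irreducible:
  assumes "finite F" "finite Z" "Z \<subseteq> V" "\<forall>e\<in>F. A e \<subseteq> V \<and> finite (A e) \<and> card (A e) = k" "2 \<le> k"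
    and "base (feas A F Z) T"
  shows "\<exists>F' S R Z' T'. F = F' \<union> S \<union> R \<and> F' \<inter> (S \<union> R) = {} \<and> S \<inter> R = {} \<and>
    irreducible_picks A F' Z' \<and> base (feas A F' Z') T' \<and> finite Z' \<and> Z' \<subseteq> V \<and>
    card T + 2 * card S + k * card R \<le> card T' + 2 * card R \<and> card Z' \<le> card Z + k * card R"
  using assms
proof (induction "card F" arbitrary: F Z T rule: less_induct)
  case less
  note prems = less.prems
  show ?case
  proof (cases "irreducible_picks A F Z")
    case True
    show ?thesis
      by (rule exI[of _ F], rule exI[of _ "{}"], rule exI[of _ "{}"], rule exI[of _ Z], rule exI[of _ T])
        (use True prems in simp)
  next
    case False
    then obtain T0 e where T0: "base (feas A F Z) T0" "e \<in> F" and
      red: "removable A (F - {e}) Z (card T0) \<or> flippable A (F - {e}) Z (card T0) e"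
      unfolding irreducible_picks_def by blast
    \<comment> \<open>All minimum sets have the same size, so the one witnessing reducibility may
      differ from \<open>T\<close>.\<close>
    have cT: "card T0 = card T" using T0(1) prems(6) unfolding base_def by (meson le_antisym)
    let ?F = "F - {e}"
    have small: "card ?F < card F" using T0(2) prems(1) by (meson card_Diff1_less)
    have fin: "finite ?F" using prems(1) by simp
    have sub: "\<forall>f\<in>?F. A f \<subseteq> V \<and> finite (A f) \<and> card (A f) = k" using prems(4) by blast
    have e: "A e \<subseteq> V" "finite (A e)" "card (A e) = k" using prems(4) T0(2) by auto
    have ne: "\<exists>X. base (feas A ?F Y) X" for Y
      by (intro base_exists feas_nonempty) (use prems(5) sub in auto)
    from red show ?thesis
    proof
      assume rem: "removable A ?F Z (card T0)"
      obtain X where X: "base (feas A ?F Z) X" using ne by blast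
      then have cX: "card T + 2 \<le> card X" using rem cT unfolding removable_def base_def by metis
      obtain F' S R Z' T' where *: "?F = F' \<union> S \<union> R" "F' \<inter> (S \<union> R) = {}" "S \<inter> R = {}"
        "irreducible_picks A F' Z'" "base (feas A F' Z') T'" "finite Z'" "Z' \<subseteq> V"
        "card X + 2 * card S + k * card R \<le> card T' + 2 * card R" "card Z' \<le> card Z + k * card R"
        using less.hyps[OF small fin prems(2,3) sub prems(5) X] by blast
      have "finite S" "e \<notin> S" "e \<notin> F'" "e \<notin> R" using *(1) fin by auto
      then have "F = F' \<union> insert e S \<union> R" "F' \<inter> (insert e S \<union> R) = {}" "insert e S \<inter> R = {}"
        "card (insert e S) = Suc (card S)"
        using * T0(2) by auto
      then show ?thesis using *(4-9) cX
        by (intro exI[of _ F'] exI[of _ "insert e S"] exI[of _ R] exI[of _ Z'] exI[of _ T'] conjI) simp_all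
    next
      assume fl: "flippable A ?F Z (card T0) e"
      obtain X where X: "base (feas A ?F (Z \<triangle> A e)) X" using ne by blast
      then have cX: "card T + k \<le> card X + 2" using fl cT e unfolding flippable_def base_def by metis
      have Z: "finite (Z \<triangle> A e)" "Z \<triangle> A e \<subseteq> V" using prems(2,3) e by auto
      have "card (Z \<triangle> A e) \<le> card (Z \<union> A e)" using prems(2) e by (intro card_mono) auto
      then have cZ: "card (Z \<triangle> A e) \<le> card Z + k" using card_Un_le[of Z "A e"] e by simp
      obtain F' S R Z' T' where *: "?F = F' \<union> S \<union> R" "F' \<inter> (S \<union> R) = {}" "S \<inter> R = {}"
        "irreducible_picks A F' Z'" "base (feas A F' Z') T'" "finite Z'" "Z' \<subseteq> V"
        "card X + 2 * card S + k * card R \<le> card T' + 2 * card R"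
        "card Z' \<le> card (Z \<triangle> A e) + k * card R"
        using less.hyps[OF small fin Z sub prems(5) X] by blast
      have "finite R" "e \<notin> S" "e \<notin> F'" "e \<notin> R" using *(1) fin by auto
      then have "F = F' \<union> S \<union> insert e R" "F' \<inter> (S \<union> insert e R) = {}" "S \<inter> insert e R = {}"
        "card (insert e R) = Suc (card R)"
        using * T0(2) by auto
      then show ?thesis using *(4-9) cX cZ
        by (intro exI[of _ F'] exI[of _ S] exI[of _ "insert e R"] exI[of _ Z'] exI[of _ T'] conjI) simp_all
    qed
  qed
qed

lemma feas_subset:
  assumes "finite F" "Z \<subseteq> V" "\<forall>e\<in>F. A e \<subseteq> V" "X \<in> feas A F Z"
  shows "X \<subseteq> V"
  using assms
proof (induction F arbitrary: X rule: finite_induct)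
  case empty
  then show ?case by (auto simp: feas_def odd_vertices_def)
next
  case (insert e F)
  obtain R P where R: "R \<in> feas A F Z" "pick (A e) P" "X = R \<triangle> P"
    using feas_insertE[OF insert.hyps(1,2) insert.prems(3)] by metis
  have "R \<subseteq> V" using insert.IH insert.prems R(1) by simp
  moreover have "P \<subseteq> V" using R(2) insert.prems(2) by (auto simp: pick_def)
  ultimately show ?case using R(3) by blast
qed

lemma even_card_symd_pair:
  assumes "finite R" "y \<noteq> v"
  shows "even (card (R \<triangle> {y, v})) \<longleftrightarrow> even (card R)"
proof -
  consider "y \<in> R" "v \<in> R" | "y \<in> R" "v \<notin> R" | "v \<in> R" "y \<notin> R" | "y \<notin> R" "v \<notin> R" by blast
  then show ?thesis
  proof cases
    case 1
    show ?thesis using card_symd_pair(1)[OF assms 1] by presburger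
  next
    case 2
    show ?thesis using card_symd_pair(2)[OF assms 2] by presburger
  next
    case 3
    show ?thesis using card_symd_pair(2)[OF assms(1) assms(2)[symmetric] 3]
      unfolding insert_commute[of v y] by presburger
  next
    case 4
    show ?thesis using card_symd_pair(3)[OF assms 4] by presburger
  qed
qed

text \<open>Each pick has either both or none of its two vertices in \<open>C\<close>, so it never
  changes the parity on \<open>C\<close>.\<close>

lemma feas_parity:
  assumes "finite F" "finite Z" "\<forall>e\<in>F. finite (A e)" "\<forall>e\<in>F. A e \<subseteq> C \<or> A e \<inter> C = {}"
    and "X \<in> feas A F Z"
  shows "even (card (X \<inter> C)) \<longleftrightarrow> even (card (Z \<inter> C))"
  using assms
proof (induction F arbitrary: X rule: finite_induct)
  case empty
  then have "X = Z" by (auto simp: feas_def odd_vertices_def)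
  then show ?case by simp
next
  case (insert e F)
  obtain R P where R: "R \<in> feas A F Z" "pick (A e) P" "X = R \<triangle> P"
    using feas_insertE[OF insert.hyps(1,2) insert.prems(4)] by metis
  obtain a b where P: "P = {a, b}" "a \<noteq> b" "a \<in> A e" "b \<in> A e" using pickE[OF R(2)] .
  have fin: "finite (R \<inter> C)" using finite_feas[OF insert.hyps(1) insert.prems(1) _ R(1)] insert.prems by simp
  have "even (card (X \<inter> C)) \<longleftrightarrow> even (card (R \<inter> C))"
  proof (cases "A e \<subseteq> C")
    case True
    then have X: "X \<inter> C = (R \<inter> C) \<triangle> {a, b}" unfolding R(3) P(1) using P by auto
    show ?thesis unfolding X by (rule even_card_symd_pair[OF fin P(2)])
  next
    case False
    then have "A e \<inter> C = {}" using insert.prems by blast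
    then have "X \<inter> C = R \<inter> C" unfolding R(3) P(1) using P by auto
    then show ?thesis by simp
  qed
  also have "\<dots> \<longleftrightarrow> even (card (Z \<inter> C))" using insert.IH insert.prems R(1) by simp
  finally show ?case .
qed

text \<open>The parallel class of \<open>u\<close> in the matroid whose bases are the minimum sets.\<close>
definition parallel_class :: "'a set set \<Rightarrow> 'a \<Rightarrow> 'a set" where
  "parallel_class \<F> u = insert u {w. (\<exists>B. base \<F> B \<and> w \<in> B) \<and> (\<forall>B. base \<F> B \<longrightarrow> u \<in> B \<longrightarrow> w \<notin> B)}"

section \<open>Structure of irreducible instances\<close>

locale irreducible =
  fixes A :: "'e \<Rightarrow> 'a set" and F :: "'e set" and Z T :: "'a set"
  assumes F: "finite F" and Z: "finite Z" and A: "\<forall>e\<in>F. finite (A e) \<and> 3 \<le> card (A e)"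
    and irr: "irreducible_picks A F Z" and T: "base (feas A F Z) T"
begin

abbreviation "H \<equiv> feas A F Z"

lemma min_pick: "base H B \<Longrightarrow> e \<in> F \<Longrightarrow> minimum_pick A (F - {e}) e Z B"
  using F Z A by (unfold_locales) (auto simp: insert_absorb)

lemma fin_H: "X \<in> H \<Longrightarrow> finite X"
  using finite_feas[OF F Z] A by blast

lemma two_in_edge: "base H B \<Longrightarrow> e \<in> F \<Longrightarrow> u \<in> A e \<Longrightarrow> v \<in> A e \<Longrightarrow> u \<in> B \<Longrightarrow> v \<in> B \<Longrightarrow> u = v"
  using minimum_pick.two_tokens[OF min_pick] irr unfolding irreducible_picks_def by metis

lemma neighbour:
  assumes "base H B" "e \<in> F" "u \<in> A e" "x \<in> A e" "u \<in> B"
  shows "\<exists>B'. base H B' \<and> x \<in> B'"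
  using minimum_pick.token_neighbour[OF min_pick[OF assms(1,2)]] irr assms
  unfolding irreducible_picks_def by (metis insert_Diff)

text \<open>Every \<open>x\<close> in \<open>A e\<close> is in some minimum set by
  \<open>neighbour\<close>. If one contained both \<open>u\<close> and \<open>x\<close>,
  transitivity would put \<open>w\<close> into a minimum set with \<open>u\<close>, which its class
  forbids, or with \<open>x\<close>, which forces \<open>w = x\<close> because a minimum set meets
  \<open>A e\<close> at most once.\<close>

lemma class_closed:
  assumes u: "u \<in> T" and e: "e \<in> F" and w: "w \<in> A e" "w \<in> parallel_class H u"
  shows "A e \<subseteq> parallel_class H u"
proof
  fix x assume x: "x \<in> A e"
  obtain B where B: "base H B" "w \<in> B" using w(2) u T unfolding parallel_class_def by blast
  obtain B' where B': "base H B'" "x \<in> B'" using neighbour[OF B(1) e w(1) x B(2)] by blast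
  have False if C: "base H C" "u \<in> C" "x \<in> C" and ne: "x \<noteq> u" for C
  proof -
    have "w \<noteq> u" using two_in_edge[OF C(1) e w(1) x _ C(3)] C(2) ne by blast
    then have nC: "\<And>D. base H D \<Longrightarrow> u \<in> D \<Longrightarrow> w \<notin> D" using w(2) unfolding parallel_class_def by blast
    obtain D where "base H D" "w \<in> D" "u \<in> D \<or> x \<in> D"
      using base_exchange_transitive[OF exchange_feas[OF F] fin_H C ne[symmetric] B] by blast
    then have "w = x" using nC two_in_edge e w(1) x by blast
    then show False using nC C by blast
  qed
  then show "x \<in> parallel_class H u" unfolding parallel_class_def using B' by blast
qed

text \<open>\<open>u\<close> and \<open>v\<close> are independent, as \<open>T\<close> contains
  both, so by transitivity no \<open>w\<close> is parallel to both.\<close>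

lemma class_disjoint:
  assumes u: "u \<in> T" "v \<in> T" "u \<noteq> v"
  shows "parallel_class H u \<inter> parallel_class H v = {}"
proof (rule ccontr)
  assume "\<not> ?thesis"
  then obtain w where w: "w \<in> parallel_class H u" "w \<in> parallel_class H v" by blast
  have "w \<noteq> u" "w \<noteq> v" using w u T unfolding parallel_class_def by blast+
  then obtain B where B: "base H B" "w \<in> B" and
    n: "\<And>D. base H D \<Longrightarrow> u \<in> D \<Longrightarrow> w \<notin> D" "\<And>D. base H D \<Longrightarrow> v \<in> D \<Longrightarrow> w \<notin> D"
    using w unfolding parallel_class_def by blast
  show False
    using base_exchange_transitive[OF exchange_feas[OF F] fin_H T u B] n by blast
qed

lemma common_neighbour:
  assumes "u \<in> T" "v \<in> T" "e \<in> F" "f \<in> F" "u \<in> A e" "v \<in> A f" "y \<in> A e" "y \<in> A f"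
  shows "u = v"
proof -
  have "y \<in> parallel_class H u" "y \<in> parallel_class H v"
    using class_closed assms unfolding parallel_class_def by blast+
  then show ?thesis using class_disjoint assms by blast
qed

text \<open>The class of \<open>u\<close> is a union of components and meets \<open>T\<close> only
  in \<open>u\<close>. By parity it meets \<open>Z\<close> in an odd number of vertices, and
  disjointness of the classes yields an injection from \<open>T\<close> into
  \<open>Z\<close>.\<close>

lemma card_le_toggle: "card T \<le> card Z"
proof -
  have "\<exists>z. z \<in> Z \<inter> parallel_class H u" if u: "u \<in> T" for u
  proof -
    let ?C = "parallel_class H u"
    have "T \<inter> ?C = {u}" using u T unfolding parallel_class_def by auto
    moreover have "\<forall>e\<in>F. A e \<subseteq> ?C \<or> A e \<inter> ?C = {}" using class_closed[OF u] by blast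
    then have "even (card (T \<inter> ?C)) \<longleftrightarrow> even (card (Z \<inter> ?C))"
      using A T unfolding base_def by (intro feas_parity[OF F Z]) auto
    ultimately have "odd (card (Z \<inter> ?C))" by simp
    then have "Z \<inter> ?C \<noteq> {}" by (metis card.empty even_zero)
    then show ?thesis by blast
  qed
  then obtain z where z: "\<And>u. u \<in> T \<Longrightarrow> z u \<in> Z \<inter> parallel_class H u" by metis
  have "inj_on z T"
  proof (rule inj_onI, rule ccontr)
    fix u v assume uv: "u \<in> T" "v \<in> T" "z u = z v" "u \<noteq> v"
    then have "z u \<in> parallel_class H u \<inter> parallel_class H v" using z[of u] z[of v] by simp
    then show False unfolding class_disjoint[OF uv(1,2,4)] by simp
  qed
  moreover have "z ` T \<subseteq> Z" using z by blast
  ultimately show ?thesis using card_inj_on_le Z by blast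
qed

end

section \<open>Counting covered pairs\<close>

lemma card_off_diagonal: "finite B \<Longrightarrow> card {(x, y). x \<in> B \<and> y \<in> B \<and> x \<noteq> y} = card B * (card B - 1)"
proof -
  assume B: "finite B"
  have "{(x, y). x \<in> B \<and> y \<in> B \<and> x \<noteq> y} = (SIGMA x:B. B - {x})" by auto
  then show ?thesis using B by (simp add: card_SigmaI)
qed

lemma pair_cover_bound:
  assumes "finite D" "finite Q" "\<forall>e\<in>D. finite (A e) \<and> card (A e) = k"
    and "\<And>u v. u \<in> Q \<Longrightarrow> v \<in> Q \<Longrightarrow> u \<noteq> v \<Longrightarrow> \<exists>e\<in>D. u \<in> A e \<and> v \<in> A e"
  shows "card Q * (card Q - 1) \<le> card D * (k * (k - 1))"
proof -
  let ?P = "\<lambda>B. {(x, y). x \<in> B \<and> y \<in> B \<and> x \<noteq> y}"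
  have fin: "finite (?P B)" if "finite B" for B
    by (rule finite_subset[of _ "B \<times> B"]) (use that in auto)
  have "card (?P Q) \<le> card (\<Union>e\<in>D. ?P (A e))"
    using assms fin by (intro card_mono) auto
  also have "\<dots> \<le> (\<Sum>e\<in>D. card (?P (A e)))" using assms(1) by (rule card_UN_le)
  also have "\<dots> = (\<Sum>e\<in>D. k * (k - 1))" using assms(3) by (intro sum.cong) (auto simp: card_off_diagonal)
  finally show ?thesis using assms(2) by (simp add: card_off_diagonal)
qed

text \<open>Used with \<open>t = card R\<close>, \<open>x = card S + 1\<close> and
  \<open>q = card T\<close>. The excluded values \<open>x = 1\<close>, \<open>t = 2\<close> give
  equality for \<open>k = 3\<close>, \<open>q = 4\<close>.\<close>

lemma pair_cover_arith:
  fixes k t x q :: nat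
  assumes "3 \<le> k" "2 \<le> t" "1 \<le> x" "x \<le> t" "x \<noteq> 1 \<or> t \<noteq> 2" "k * t + 2 * x \<le> q + 2 * t"
  shows "(t + x - 1) * (k * (k - 1)) < q * (q - 1)"
proof -
  \<comment> \<open>Substituting natural-number offsets for \<open>k\<close>, \<open>t\<close> and
    \<open>x\<close> removes truncated subtraction. Below, \<open>p + 1\<close> is the lower bound
    on \<open>q\<close> in these terms, which leaves a comparison of polynomials.\<close>
  obtain a where k: "k = a + 3" using assms(1) by (metis le_Suc_ex add.commute)
  obtain m where t: "t = x + m" using assms(4) by (metis le_Suc_ex)
  have q: "(a + 1) * t + 2 * x \<le> q" using assms(6) unfolding k by (simp add: algebra_simps)
  show ?thesis
  proof (cases "x = 1")
    case True
    have "2 \<le> m" using assms(2,5) True t by linarith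
    then obtain n where m: "m = n + 2" by (metis le_Suc_ex add.commute)
    define p where "p = (a + 1) * (n + 3) + 1"
    have p: "p + 1 \<le> q" using q unfolding t m True p_def by (simp add: algebra_simps)
    have "(t + x - 1) * (k * (k - 1)) < (p + 1) * p"
      unfolding t m True k p_def by (simp add: algebra_simps)
    also have "\<dots> \<le> q * (q - 1)" using p by (intro mult_mono) auto
    finally show ?thesis .
  next
    case False
    then have "2 \<le> x" using assms(3) by linarith
    then obtain y where x: "x = y + 2" by (metis le_Suc_ex add.commute)
    define p where "p = (a + 3) * y + 2 * a + 5 + (a + 1) * m"
    have p: "p + 1 \<le> q" using q unfolding t x p_def by (simp add: algebra_simps)
    have "(t + x - 1) * (k * (k - 1)) < (p + 1) * p"
      unfolding t x k p_def by (simp add: algebra_simps)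
    also have "\<dots> \<le> q * (q - 1)" using p by (intro mult_mono) auto
    finally show ?thesis .
  qed
qed

theorem empty_feasible:
  assumes V: "finite V" and E: "finite E" "2 \<le> card E"
    and AV: "\<forall>e\<in>E. A e \<subseteq> V \<and> card (A e) = k" and k: "3 \<le> k"
    and cover: "\<And>u v. u \<in> V \<Longrightarrow> v \<in> V \<Longrightarrow> u \<noteq> v \<Longrightarrow> \<exists>e\<in>E. u \<in> A e \<and> v \<in> A e"
  shows "{} \<in> feas A E {}"
proof (rule ccontr)
  assume no: "{} \<notin> feas A E {}"
  have fA: "\<forall>e\<in>E. finite (A e)" using AV V finite_subset by blast
  have "feas A E {} \<noteq> {}" by (rule feas_nonempty) (use fA AV k in auto)
  then obtain T0 where T0: "base (feas A E {}) T0" using base_exists by blast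
  have "finite T0" using finite_feas[OF E(1) _ fA] T0 unfolding base_def by blast
  moreover have "T0 \<noteq> {}" using no T0 unfolding base_def by blast
  \<comment> \<open>With \<open>C = UNIV\<close> and an empty target, \<open>feas_parity\<close>
    says that all feasible sets have even size.\<close>
  moreover have "even (card T0)"
    using feas_parity[of E "{}" A UNIV T0] E(1) fA T0 unfolding base_def by simp
  ultimately have c0: "2 \<le> card T0" by (metis card_0_eq dvd_imp_le gr0I)
  have "\<forall>e\<in>E. A e \<subseteq> V \<and> finite (A e) \<and> card (A e) = k" "2 \<le> k" using AV fA k by auto
  note reduced = reduce_to_irreducible[OF E(1) finite.emptyI empty_subsetI this T0]
  obtain F S R Z T where *: "E = F \<union> S \<union> R" "F \<inter> (S \<union> R) = {}" "S \<inter> R = {}"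
    "irreducible_picks A F Z" "base (feas A F Z) T" "finite Z" "Z \<subseteq> V"
    "card T0 + 2 * card S + k * card R \<le> card T + 2 * card R" "card Z \<le> k * card R"
    using reduced unfolding card.empty add_0 by (elim exE conjE) (rule that)
  have fin: "finite F" "finite S" "finite R" using *(1) E(1) by auto
  interpret irreducible A F Z T
    using * fin fA AV k by unfold_locales auto
  have "T \<in> feas A F Z" using *(5) by (simp add: base_def)
  then have TV: "T \<subseteq> V" by (rule feas_subset[OF fin(1) *(7), rotated]) (use AV *(1) in auto)
  then have fT: "finite T" using V finite_subset by blast
  have q: "card T \<le> k * card R" using card_le_toggle *(9) by simp
  have q2: "2 + 2 * card S + k * card R \<le> card T + 2 * card R" using *(8) c0 by simp
  \<comment> \<open>The bounds \<open>2 + 2 * card S + (k - 2) * card R \<le> card T \<le> k * card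
    R\<close> leave exactly this; in particular some edge was toggled.\<close>
  have sr: "card S + 1 \<le> card R" using q q2 by linarith
  have covT: "\<exists>e\<in>S \<union> R. u \<in> A e \<and> v \<in> A e" if uv: "u \<in> T" "v \<in> T" "u \<noteq> v" for u v
  proof -
    obtain e where "e \<in> E" "u \<in> A e" "v \<in> A e" using cover uv TV by blast
    then show ?thesis using two_in_edge[OF *(5)] uv *(1) by blast
  qed
  have cD: "card (S \<union> R) = card S + card R" using *(3) fin card_Un_disjoint by blast
  have uni: "\<forall>e\<in>S \<union> R. finite (A e) \<and> card (A e) = k" using AV fA *(1) by auto
  have sub_card: "card T \<le> k" if "e \<in> S \<union> R" "T \<subseteq> A e" for e
    using that uni card_mono by metis
  consider "card R = 1" | "card R = 2" "card S = 0" | "2 \<le> card R" "card S \<noteq> 0 \<or> card R \<noteq> 2"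
    using sr by linarith
  then show False
  proof cases
    case 1
    then obtain e where e: "R = {e}" by (rule card_1_singletonE)
    have S: "S = {}" using sr 1 fin by simp
    have cT: "k \<le> card T" using q2 S e by simp
    have "T \<subseteq> A e"
    proof
      fix x assume x: "x \<in> T"
      have "\<not> T \<subseteq> {x}" using cT k card_mono[of "{x}" T] by auto
      then show "x \<in> A e" using covT[OF x] S e by blast
    qed
    then have Te: "T = A e" using card_subset_eq[of "A e" T] sub_card[of e] cT uni e by auto
    have "F \<noteq> {}" using E(2) *(1) S e by auto
    then obtain f where f: "f \<in> F" by blast
    have "\<not> A f \<subseteq> T"
    proof
      \<comment> \<open>A remaining edge inside \<open>T\<close> would contain two vertices of a
        minimum set.\<close>
      assume "A f \<subseteq> T"
      moreover have "\<exists>P. pick (A f) P"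
        unfolding pick_def by (rule obtain_subset_with_card_n[of 2 "A f"]) (use AV k f *(1) in auto)
      then obtain a b where "a \<in> A f" "b \<in> A f" "a \<noteq> b" using pickE by metis
      ultimately show False using two_in_edge[OF *(5) f] by blast
    qed
    then obtain y where y: "y \<in> A f" "y \<notin> T" by blast
    then have yV: "y \<in> V" using AV f *(1) by blast
    \<comment> \<open>As \<open>y\<close> is outside \<open>A e = T\<close>, the edge covering
      \<open>u\<close> and \<open>y\<close> is not \<open>e\<close> and hence remains. So all of
      \<open>T\<close> has the common neighbour \<open>y\<close>, although distinct elements of
      \<open>T\<close> have no common neighbour.\<close>
    have yF: "\<exists>g\<in>F. u \<in> A g \<and> y \<in> A g" if u: "u \<in> T" for u
    proof -
      obtain g where "g \<in> E" "u \<in> A g" "y \<in> A g" using cover[of u y] u TV yV y by blast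
      then show ?thesis using *(1) S e y Te by blast
    qed
    obtain u where u: "u \<in> T" using cT k by fastforce
    have "\<not> T \<subseteq> {u}" using cT k card_mono[of "{u}" T] by auto
    then obtain v where "v \<in> T" "v \<noteq> u" by blast
    then show False using common_neighbour u yF by blast
  next
    case 2
    then obtain e f where ef: "R = {e, f}" by (metis card_2_iff)
    have S: "S = {}" using 2 fin by simp
    \<comment> \<open>Two edges can cover all pairs of \<open>T\<close> only if one of them contains
      \<open>T\<close>. But \<open>card T\<close> is at least \<open>2 * k - 2\<close>, which
      exceeds \<open>k\<close>.\<close>
    have "T \<subseteq> A e \<or> T \<subseteq> A f"
    proof (rule ccontr)
      assume "\<not> ?thesis"
      then obtain x y where xy: "x \<in> T" "x \<notin> A e" "y \<in> T" "y \<notin> A f" by blast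
      have "\<not> T \<subseteq> {x}" using q2 2 k card_mono[of "{x}" T] by auto
      then have "x \<in> A f" using covT[OF xy(1)] S ef xy by blast
      then have "x \<noteq> y" using xy by blast
      then show False using covT[OF xy(1,3)] S ef xy by blast
    qed
    then have "card T \<le> k" using sub_card ef by blast
    then show False using q2 2 k by simp
  next
    case 3
    have "card T * (card T - 1) \<le> card (S \<union> R) * (k * (k - 1))"
      by (rule pair_cover_bound) (use fin fT uni covT in auto)
    moreover have "(card R + (card S + 1) - 1) * (k * (k - 1)) < card T * (card T - 1)"
      by (rule pair_cover_arith) (use k 3 sr q2 in auto)
    ultimately show False by (simp add: cD add.commute)
  qed
qed

subsection \<open>Closed trails\<close>

text \<open>Each edge acts only through its chosen pair, so these are trails of an ordinary
  multigraph once the edge list is distinct.\<close>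

fun trail :: "('e \<Rightarrow> 'a set) \<Rightarrow> 'a \<Rightarrow> 'e list \<Rightarrow> 'a \<Rightarrow> bool" where
  "trail p u [] v \<longleftrightarrow> u = v"
| "trail p u (e # es) v \<longleftrightarrow> (\<exists>w. w \<noteq> u \<and> p e = {u, w} \<and> trail p w es v)"

lemma trail_append: "trail p u (xs @ ys) v \<longleftrightarrow> (\<exists>w. trail p u xs w \<and> trail p w ys v)"
  by (induction xs arbitrary: u) auto

lemma odd_vertices_trail:
  "trail p u es v \<Longrightarrow> distinct es \<Longrightarrow> odd_vertices (set es) p = {u} \<triangle> {v}"
proof (induction es arbitrary: u)
  case Nil
  then show ?case by (simp add: odd_vertices_def)
next
  case (Cons e es)
  then obtain w where w: "w \<noteq> u" "p e = {u, w}" "trail p w es v" by auto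
  have "odd_vertices (set (e # es)) p = ({w} \<triangle> {v}) \<triangle> {u, w}"
    using odd_vertices_insert[of "set es" e p] Cons.IH[OF w(3)] Cons.prems w(2) by simp
  then show ?case using w(1) by auto
qed

lemma rotate_trail:
  assumes t: "trail p u es u" and e: "e \<in> set es" "x \<in> p e"
  obtains es' where "trail p x es' x" "set es' = set es" "length es' = length es" "distinct es' = distinct es"
proof -
  obtain as bs where es: "es = as @ e # bs" using e by (meson split_list)
  then obtain y w where yw: "trail p u as y" "w \<noteq> y" "p e = {y, w}" "trail p w bs u"
    using t by (auto simp: trail_append)
  show thesis
  proof (cases "x = y")
    case True
    have "trail p x (e # bs @ as) x" using yw True by (auto simp: trail_append)
    then show thesis by (rule that) (auto simp: es)
  next
    case False
    then have "trail p x (bs @ as @ [e]) x" using yw e by (auto simp: trail_append insert_commute)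
    then show thesis by (rule that) (auto simp: es)
  qed
qed

text \<open>Split off a longest trail, which must be closed, and recurse on the remaining edges.
  Maximality also keeps the later trails away from its vertices.\<close>

lemma trail_family:
  assumes "finite X" "\<forall>e\<in>X. card (p e) = 2" "odd_vertices X p = {}"
  shows "\<exists>C. (\<forall>es\<in>C. es \<noteq> [] \<and> distinct es \<and> (\<exists>u. trail p u es u)) \<and>
    pairwise (\<lambda>es es'. \<Union>(p ` set es) \<inter> \<Union>(p ` set es') = {}) C \<and> \<Union>(set ` C) = X"
  using assms
proof (induction "card X" arbitrary: X rule: less_induct)
  case less
  note X = less.prems
  show ?case
  proof (cases "X = {}")
    case True
    then show ?thesis by (intro exI[of _ "{}"]) simp
  next
    case False
    define P where "P = (\<lambda>es. distinct es \<and> set es \<subseteq> X \<and> (\<exists>u v. trail p u es v))"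
    obtain e0 where e0: "e0 \<in> X" using False by blast
    then obtain a b where "p e0 = {a, b}" "a \<noteq> b" using X(2) by (metis card_2_iff)
    then have "trail p a [e0] b" by auto
    then have "\<exists>u v. trail p u [e0] v" by blast
    then have P0: "P [e0]" using e0 unfolding P_def by (simp del: trail.simps)
    have "length es < Suc (card X)" if "P es" for es
      using that X(1) card_mono[of X "set es"] distinct_card[of es] unfolding P_def by fastforce
    then obtain es where es: "P es" "\<And>es'. P es' \<Longrightarrow> length es' \<le> length es"
      using ex_has_greatest_nat[of P "[e0]" length "Suc (card X)"] P0 by metis
    then obtain u v where t: "distinct es" "set es \<subseteq> X" "trail p u es v" unfolding P_def by blast
    have ne: "es \<noteq> []" using es(2)[OF P0] by auto
    have "u = v"
    proof (rule ccontr)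
      assume "u \<noteq> v"
      then have "v \<in> odd_vertices (set es) p" using odd_vertices_trail[OF t(3,1)] by simp
      then have "odd (card {e \<in> set es. v \<in> p e})" by (simp add: odd_vertices_def)
      moreover have "even (card {e \<in> X. v \<in> p e})" using X(3) unfolding odd_vertices_def by blast
      ultimately have "{e \<in> X. v \<in> p e} \<noteq> {e \<in> set es. v \<in> p e}" by metis
      then obtain e where e: "e \<in> X" "v \<in> p e" "e \<notin> set es" using t(2) by blast
      then obtain w where "p e = {v, w}" "w \<noteq> v"
        using X(2) by (metis card_2_iff doubleton_eq_iff insertE singletonD)
      then have "trail p u (es @ [e]) w" using t(3) by (auto simp: trail_append)
      then have "P (es @ [e])" using t e unfolding P_def by auto
      then show False using es(2) by fastforce
    qed
    note closed = t(3)[folded this]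
    let ?Y = "X - set es"
    have "hd es \<in> set es" using ne by simp
    then have "?Y \<subset> X" using t(2) by blast
    then have "card ?Y < card X" using X(1) by (intro psubset_card_mono)
    moreover have "odd_vertices ?Y p = {}"
    proof -
      have "odd (card {e \<in> ?Y. x \<in> p e}) \<longleftrightarrow> False" for x
      proof -
        have "{e \<in> X. x \<in> p e} = {e \<in> ?Y. x \<in> p e} \<union> {e \<in> set es. x \<in> p e}" using t(2) by auto
        then have "card {e \<in> X. x \<in> p e} = card {e \<in> ?Y. x \<in> p e} + card {e \<in> set es. x \<in> p e}"
          using X(1) card_Un_disjoint[of "{e \<in> ?Y. x \<in> p e}" "{e \<in> set es. x \<in> p e}"] by fastforce
        moreover have "even (card {e \<in> set es. x \<in> p e})"
          using odd_vertices_trail[OF closed t(1)] unfolding odd_vertices_def by blast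
        moreover have "even (card {e \<in> X. x \<in> p e})" using X(3) unfolding odd_vertices_def by blast
        ultimately show ?thesis by simp
      qed
      then show ?thesis unfolding odd_vertices_def by blast
    qed
    moreover have "finite ?Y" "\<forall>e\<in>?Y. card (p e) = 2" using X by auto
    ultimately obtain C where C: "\<forall>es\<in>C. es \<noteq> [] \<and> distinct es \<and> (\<exists>u. trail p u es u)"
      "pairwise (\<lambda>es es'. \<Union>(p ` set es) \<inter> \<Union>(p ` set es') = {}) C" "\<Union>(set ` C) = ?Y"
      using less.hyps[of ?Y] by blast
    text \<open>A closed trail meeting the longest one could be spliced into it.\<close>
    have disj: "\<Union>(p ` set es) \<inter> \<Union>(p ` set es') = {}" if es'C: "es' \<in> C" for es'
    proof (rule ccontr)
      assume "\<not> ?thesis"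
      then obtain x e e' where x: "e \<in> set es" "x \<in> p e" "e' \<in> set es'" "x \<in> p e'" by blast
      obtain u' where u': "trail p u' es' u'" "distinct es'" "es' \<noteq> []" using C(1) es'C by blast
      have sY: "set es' \<subseteq> ?Y" using C(3) es'C by blast
      obtain as where as: "trail p x as x" "set as = set es" "length as = length es" "distinct as = distinct es"
        using rotate_trail[OF closed x(1,2)] .
      obtain bs where bs: "trail p x bs x" "set bs = set es'" "length bs = length es'" "distinct bs = distinct es'"
        using rotate_trail[OF u'(1) x(3,4)] .
      have "trail p x (as @ bs) x" using as bs by (auto simp: trail_append)
      moreover have "distinct (as @ bs)" "set (as @ bs) \<subseteq> X" using as bs sY t(1,2) u'(2) by auto
      ultimately have "P (as @ bs)" unfolding P_def by blast
      then show False using es(2)[of "as @ bs"] as(3) bs(3) u'(3) by simp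
    qed
    have "pairwise (\<lambda>es es'. \<Union>(p ` set es) \<inter> \<Union>(p ` set es') = {}) (insert es C)"
      using C(2) disj unfolding pairwise_insert by blast
    moreover have "\<Union>(set ` insert es C) = X" using C(3) t(2) by auto
    moreover have "\<forall>es\<in>insert es C. es \<noteq> [] \<and> distinct es \<and> (\<exists>u. trail p u es u)"
      using C(1) ne t(1) closed by blast
    ultimately show ?thesis by blast
  qed
qed

lemma trail_anchors:
  assumes "trail p u es v"
  shows "\<exists>vs. length vs = Suc (length es) \<and> hd vs = u \<and> last vs = v \<and>
    (\<forall>i<length es. p (es ! i) = {vs ! i, vs ! Suc i} \<and> vs ! i \<noteq> vs ! Suc i)"
  using assms
proof (induction es arbitrary: u)
  case Nil
  then show ?case by (intro exI[of _ "[u]"]) simp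
next
  case (Cons e es)
  then obtain w where w: "w \<noteq> u" "p e = {u, w}" "trail p w es v" by auto
  then obtain vs where vs: "length vs = Suc (length es)" "hd vs = w" "last vs = v"
    "\<forall>i<length es. p (es ! i) = {vs ! i, vs ! Suc i} \<and> vs ! i \<noteq> vs ! Suc i"
    using Cons.IH by blast
  have ne: "vs \<noteq> []" using vs(1) by auto
  have "p ((e # es) ! i) = {(u # vs) ! i, (u # vs) ! Suc i} \<and> (u # vs) ! i \<noteq> (u # vs) ! Suc i"
    if "i < length (e # es)" for i
    using that w vs ne by (cases i) (auto simp: hd_conv_nth)
  then show ?case using vs ne by (intro exI[of _ "u # vs"]) simp
qed

section \<open>From pair choices to Euler families\<close>

lemma finite_edges: "finite (edges E)"
  and card_edges: "card (edges E) = size E"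
proof -
  have eq: "edges E = (SIGMA e:set_mset E. {..<count E e})"
    unfolding edges_def by (auto simp: count_greater_zero_iff[symmetric] simp del: count_greater_zero_iff)
  show "finite (edges E)" unfolding eq by simp
  show "card (edges E) = size E" unfolding eq by (simp add: size_multiset_overloaded_eq)
qed

text \<open>The anchors of a trail lie in its chosen pairs. Vertex-disjointness of these pairs
  therefore gives disjoint anchors and, since no pair is empty, disjoint edge sets.\<close>

lemma euler_family_if_feasible:
  assumes V: "\<forall>e\<in>#E. e \<subseteq> V" and feas: "{} \<in> feas fst (edges E) {}"
  shows "\<exists>F. euler_family V E F"
proof -
  obtain p where p: "p \<in> picks fst (edges E)" "odd_vertices (edges E) p = {}"
    using feas unfolding feas_def by auto
  have pE: "p e \<subseteq> fst e" "card (p e) = 2" if "e \<in> edges E" for e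
    using p(1) that unfolding picks_def pick_def by auto
  have EV: "fst e \<subseteq> V" if "e \<in> edges E" for e
  proof -
    have "fst e \<in># E" using that unfolding edges_def by (auto simp: count_greater_zero_iff[symmetric] simp del: count_greater_zero_iff)
    then show ?thesis using V by blast
  qed
  have "\<forall>e\<in>edges E. card (p e) = 2" using pE by blast
  from trail_family[OF finite_edges this p(2)]
  obtain C where C0: "\<forall>es\<in>C. es \<noteq> [] \<and> distinct es \<and> (\<exists>u. trail p u es u)"
    and C: "pairwise (\<lambda>es es'. \<Union>(p ` set es) \<inter> \<Union>(p ` set es') = {}) C" "\<Union>(set ` C) = edges E"
    by (elim exE conjE)
  have "\<exists>vs. length vs = Suc (length es) \<and> hd vs = last vs \<and>
    (\<forall>i<length es. p (es ! i) = {vs ! i, vs ! Suc i} \<and> vs ! i \<noteq> vs ! Suc i)" if "es \<in> C" for es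
    using C0[rule_format, OF that] trail_anchors by metis
  then obtain a where a: "\<And>es. es \<in> C \<Longrightarrow> length (a es) = Suc (length es) \<and> hd (a es) = last (a es) \<and>
    (\<forall>i<length es. p (es ! i) = {a es ! i, a es ! Suc i} \<and> a es ! i \<noteq> a es ! Suc i)" by metis
  have anch: "set (a es) \<subseteq> \<Union>(p ` set es)" if esC: "es \<in> C" for es
  proof
    fix x assume "x \<in> set (a es)"
    then obtain j where j: "j < Suc (length es)" "x = a es ! j" using a[OF esC] by (metis in_set_conv_nth)
    have "length es \<noteq> 0" using C0[rule_format, OF esC] by simp
    then obtain i where i: "i < length es" "j = i \<or> j = Suc i"
      using j(1) by (metis Suc_pred less_Suc_eq lessI not_gr0)
    then have "x \<in> p (es ! i)" using a[OF esC] j by auto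
    then show "x \<in> \<Union>(p ` set es)" using i nth_mem by blast
  qed
  have inE: "set es \<subseteq> edges E" if "es \<in> C" for es using C(2) that by blast
  have "euler_family V E ((\<lambda>es. (a es, es)) ` C)"
    unfolding euler_family_def
  proof (intro conjI ballI)
    fix W assume "W \<in> (\<lambda>es. (a es, es)) ` C"
    then obtain es where es: "es \<in> C" "W = (a es, es)" by blast
    have "set (a es) \<subseteq> V" using anch[OF es(1)] inE[OF es(1)] pE(1) EV by blast
    moreover have "p (es ! i) \<subseteq> fst (es ! i)" if "i < length es" for i
      using pE(1) inE[OF es(1)] that nth_mem by blast
    ultimately show "is_trail V E W"
      unfolding is_trail_def is_walk_def es(2) using a[OF es(1)] C0[rule_format, OF es(1)] inE[OF es(1)] by auto
    \<comment> \<open>A trail with a single edge would end at a vertex different from its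
      start.\<close>
    have "2 \<le> length es"
    proof (rule ccontr)
      assume "\<not> 2 \<le> length es"
      then have one: "length es = 1" using C0[rule_format, OF es(1)] by (metis One_nat_def Suc_1 length_0_conv less_2_cases not_le)
      then have "length (a es) = 2" "a es ! 0 \<noteq> a es ! 1" using a[OF es(1)] by auto
      moreover from this(1) have "a es \<noteq> []" by auto
      ultimately show False using a[OF es(1)] by (auto simp: hd_conv_nth last_conv_nth)
    qed
    then show "closed_walk W" unfolding closed_walk_def es(2) using a[OF es(1)] by simp
  next
    have "set (a es) \<inter> set (a es') = {}" if "es \<in> C" "es' \<in> C" "es \<noteq> es'" for es es'
      using anch[OF that(1)] anch[OF that(2)] pairwiseD[OF C(1) that] by blast
    then show "pairwise (\<lambda>W W'. anchors W \<inter> anchors W' = {}) ((\<lambda>es. (a es, es)) ` C)"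
      unfolding pairwise_def anchors_def by auto
  next
    have "set es \<inter> set es' = {}" if "es \<in> C" "es' \<in> C" "es \<noteq> es'" for es es'
    proof (rule ccontr)
      assume "\<not> ?thesis"
      then obtain e where e: "e \<in> set es" "e \<in> set es'" by blast
      then have "p e \<noteq> {}" using pE(2) inE that by fastforce
      then show False using C(1) that e unfolding pairwise_def by blast
    qed
    then show "pairwise (\<lambda>W W'. walk_edges W \<inter> walk_edges W' = {}) ((\<lambda>es. (a es, es)) ` C)"
      unfolding pairwise_def walk_edges_def by auto
  next
    show "(\<Union>W\<in>(\<lambda>es. (a es, es)) ` C. walk_edges W) = edges E"
      using C(2) unfolding walk_edges_def by simp
  qed
  then show ?thesis by blast
qed

theorem theorem1p2:
  fixes l k :: nat and V :: "'a set" and E :: "'a set multiset"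
  assumes "2 \<le> l" and "l < k"
    and "covering_hypergraph l k V E"
  shows "(\<exists>F. euler_family V E F) \<longleftrightarrow> size E \<ge> 2"
proof -
  have H: "finite V" "\<forall>e\<in>#E. e \<subseteq> V" "E \<noteq> {#}" "\<forall>e\<in>#E. card e = k"
    "\<And>S. S \<subseteq> V \<Longrightarrow> card S = l \<Longrightarrow> \<exists>e\<in>#E. S \<subseteq> e"
    using assms(3) unfolding covering_hypergraph_def hypergraph_def uniform_def by auto
  show ?thesis
  proof
    assume "\<exists>F. euler_family V E F"
    then obtain F where F: "euler_family V E F" ..
    \<comment> \<open>A non-empty edge set forces a closed trail, whose edges are distinct and
      number at least two.\<close>
    have "card (edges E) \<noteq> 0" unfolding card_edges using H(3) by simp
    then have "edges E \<noteq> {}" by auto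
    then obtain W where "W \<in> F" using F unfolding euler_family_def by blast
    then have W: "distinct (snd W)" "2 \<le> length (snd W)" "set (snd W) \<subseteq> edges E"
      using F unfolding euler_family_def is_trail_def closed_walk_def walk_edges_def by blast+
    then have "2 \<le> card (edges E)"
      using card_mono[OF finite_edges W(3)] distinct_card[OF W(1)] by simp
    then show "2 \<le> size E" unfolding card_edges .
  next
    assume size: "2 \<le> size E"
    have mem: "e \<in># E \<longleftrightarrow> (\<exists>i. (e, i) \<in> edges E)" for e
      unfolding edges_def by (auto simp: count_greater_zero_iff[symmetric] simp del: count_greater_zero_iff)
    obtain e0 where e0: "e0 \<in># E" using H(3) by blast
    then have "k \<le> card V" using H(1,2,4) card_mono by metis
    have "\<exists>e\<in>edges E. u \<in> fst e \<and> v \<in> fst e" if "u \<in> V" "v \<in> V" "u \<noteq> v" for u v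
    proof -
      \<comment> \<open>The pair is enlarged to an \<open>l\<close>-subset of \<open>V\<close>; an
        edge of size \<open>k\<close> ensures that \<open>V\<close> is large enough. Only the
        covering of pairs is used from here on.\<close>
      have "card {u, v} \<le> l" "l \<le> card V" "{u, v} \<subseteq> V" using that assms(1,2) \<open>k \<le> card V\<close> by auto
      then obtain S where "{u, v} \<subseteq> S" "S \<subseteq> V" "card S = l"
        using exists_subset_between[of "{u, v}" l V] H(1) by blast
      then obtain e where "e \<in># E" "u \<in> e" "v \<in> e" using H(5)[of S] by blast
      moreover from this(1) obtain i where "(e, i) \<in> edges E" using mem by blast
      ultimately show ?thesis by (intro bexI[of _ "(e, i)"]) simp_all
    qed
    moreover have "\<forall>e\<in>edges E. fst e \<subseteq> V \<and> card (fst e) = k" using H(2,4) mem by fastforce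
    ultimately have "{} \<in> feas fst (edges E) {}"
      using assms(1,2) size H(1) finite_edges by (intro empty_feasible[of V _ _ k]) (auto simp: card_edges)
    then show "\<exists>F. euler_family V E F" using euler_family_if_feasible H(2) by blast
  qed
qed

end
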